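(* Consider any estimand $\theta(\mathbf{A},\mathbf{B})=g(\mathbf{Y}(\mathbf{A}),\mathbf{Y}(\mathbf{B}))$, and suppose that $g$ is onto $[0,M]$, i.e. for every $x\in[0,M]$ there exist (admissible) $\mathbf{Y}(\mathbf{A}),\mathbf{Y}(\mathbf{B})$ such that $g(\mathbf{Y}(\mathbf{A}),\mathbf{Y}(\mathbf{B}))=x$. Then, under arbitrary interference, for every sample size $N\ge 2$ and every estimator $\hat\theta(\mathbf{Z})$ there exist potential outcomes $\{\mathbf{Y}(\mathbf{Z})\}_{\mathbf{Z}\in\mathcal{Z}}$ satisfying $0<Y_i(\mathbf{Z})<M$ for all $i$ and all $\mathbf{Z}$ such that $$\mathrm{MSE}(\hat\theta,\theta) \;\geq\; \frac{M^2}{8},$$ where the MSE is taken under the Completely Randomized Design or under the Bernoulli Design (the statement holds for each of the two designs).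
   Context: There are $N$ units, each assigned to treatment $A$ or $B$. The assignment vector $\mathbf{Z}$ takes values in $\mathcal{Z}=\{A,B\}^N$; $\mathbf{A}=(A,\dots,A)$ and $\mathbf{B}=(B,\dots,B)$ are the assignments giving all units $A$, respectively all units $B$. For each $\mathbf{Z}\in\mathcal{Z}$ there is a fixed (non-random) vector of potential outcomes $\mathbf{Y}(\mathbf{Z})=(Y_1(\mathbf{Z}),\dots,Y_N(\mathbf{Z}))$. Here $M>0$ is a fixed constant (not depending on $N$), and admissible outcome vectors are those in $(0,M)^N$. Arbitrary interference means that there is no other restriction: the family $\{\mathbf{Y}(\mathbf{Z})\}_{\mathbf{Z}\in\mathcal{Z}}$ may be any family of vectors in $(0,M)^N$, with no constraint relating $\mathbf{Y}(\mathbf{Z})$ and $\mathbf{Y}(\mathbf{Z}')$ for $\mathbf{Z}\neq\mathbf{Z}'$. A design is a probability distribution on $\mathcal{Z}$; it is the only source of randomness. The Completely Randomized Design fixes integers $N_A,N_B\ge 1$ with $N_A+N_B=N$ and is the uniform distribution on the assignments with exactly $N_A$ units assigned to $A$ and $N_B$ to $B$. The Bernoulli Design assigns each unit independently to $A$ or $B$ with probability $1/2$ each. The function $g$ defining the estimand is real-valued. An estimator $\hat\theta(\mathbf{Z})$ is a real-valued function of the observed data, i.e. of the realized assignment $\mathbf{Z}$ and the observed outcome vector $\mathbf{Y}(\mathbf{Z})$ only. The mean squared error is $\mathrm{MSE}(\hat\theta,\theta)=\mathbb{E}_{\mathcal{R}}\big[(\hat\theta(\mathbf{Z})-\theta(\mathbf{A},\mathbf{B}))^2\big]$,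 the expectation being over $\mathbf{Z}$ drawn from the design $\mathcal{R}$, with the potential outcomes fixed. *)

theory Defs
  imports "HOL-Probability.Probability" "HOL-Probability.Product_PMF"
begin

datatype treatment = TrtA | TrtB

instance treatment :: finite
proof
  have "UNIV = {TrtA, TrtB}"
    using treatment.exhaust by auto
  then show "finite (UNIV :: treatment set)"
    by (metis finite.emptyI finite.insertI)
qed

text \<open>The units are the elements of a finite type, so the sample size is its cardinality.
  Both \<open>all_A\<close> and \<open>all_B\<close> are ordinary assignments: a family of potential outcomes
  assigns an outcome vector to every element of \<open>'n assignment\<close>, these two included.\<close>

type_synonym 'n assignment = "'n \<Rightarrow> treatment"

type_synonym 'n potential_outcomes = "'n assignment \<Rightarrow> real ^ 'n"

type_synonym 'n estimator = "'n assignment \<Rightarrow> real ^ 'n \<Rightarrow> real"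

definition all_A :: "'n assignment" where
  "all_A = (\<lambda>_. TrtA)"

definition all_B :: "'n assignment" where
  "all_B = (\<lambda>_. TrtB)"

definition admissible :: "real \<Rightarrow> (real ^ 'n) set" where
  "admissible M = {y. \<forall>i. 0 < y $ i \<and> y $ i < M}"

definition onto_estimand :: "real \<Rightarrow> (real ^ 'n \<Rightarrow> real ^ 'n \<Rightarrow> real) \<Rightarrow> bool" where
  "onto_estimand M g \<longleftrightarrow>
     (\<forall>x\<in>{0..M}. \<exists>yA\<in>admissible M. \<exists>yB\<in>admissible M. g yA yB = x)"

definition estimand ::
  "(real ^ 'n \<Rightarrow> real ^ 'n \<Rightarrow> real) \<Rightarrow> 'n potential_outcomes \<Rightarrow> real" where
  "estimand g Y = g (Y all_A) (Y all_B)"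

text \<open>The set below is nonempty, so that \<open>pmf_of_set\<close> is meaningful, exactly when
  \<open>NA + NB\<close> is the number of units.\<close>

definition completely_randomized :: "nat \<Rightarrow> nat \<Rightarrow> 'n::finite assignment pmf" where
  "completely_randomized NA NB =
     pmf_of_set {Z. card {i. Z i = TrtA} = NA \<and> card {i. Z i = TrtB} = NB}"

text \<open>The second argument of \<open>Pi_pmf\<close> is the value off the index set and is irrelevant here.\<close>

definition bernoulli_design :: "'n::finite assignment pmf" where
  "bernoulli_design = Pi_pmf UNIV TrtA (\<lambda>_. pmf_of_set {TrtA, TrtB})"

text \<open>The estimator sees the outcomes only through the observed vector \<open>Y Z\<close>.\<close>

definition MSE ::
  "'n assignment pmf \<Rightarrow> 'n estimator \<Rightarrow> (real ^ 'n \<Rightarrow> real ^ 'n \<Rightarrow> real) \<Rightarrow>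
   'n potential_outcomes \<Rightarrow> real" where
  "MSE R T g Y = measure_pmf.expectation R (\<lambda>Z. (T Z (Y Z) - estimand g Y)\<^sup>2)"

end

theory Submission
  imports Defs
begin

text \<open>Le Cam's two-point method: choose one family with estimand \<open>0\<close> and one with estimand \<open>M\<close>
  that differ only at \<open>all_A\<close> and \<open>all_B\<close>. At every other assignment the estimator returns the same
  value \<open>t\<close> for both, and \<open>t\<^sup>2 + (t - M)\<^sup>2 \<ge> M\<^sup>2 / 2\<close>. Both designs give the
  other assignments probability at least \<open>1/2\<close>, so the two errors add up to at least \<open>M\<^sup>2 / 4\<close>.\<close>

lemma MSE_eq_sum:
  fixes R :: "'n::finite assignment pmf"
  shows "MSE R T g Y = (\<Sum>Z\<in>UNIV. pmf R Z * (T Z (Y Z) - estimand g Y)\<^sup>2)"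
  unfolding MSE_def by (subst integral_measure_pmf[of UNIV]) auto

lemma sum_squares_two_points:
  fixes t m :: real
  shows "m\<^sup>2 / 2 \<le> t\<^sup>2 + (t - m)\<^sup>2"
proof -
  have "t\<^sup>2 + (t - m)\<^sup>2 - m\<^sup>2 / 2 = (2 * t - m)\<^sup>2 / 2"
    by (simp add: power2_eq_square field_simps)
  then show ?thesis
    using zero_le_power2[of "2 * t - m"] by linarith
qed

lemma all_A_neq_all_B: "all_A \<noteq> (all_B :: 'n assignment)"
  by (simp add: all_A_def all_B_def fun_eq_iff)

text \<open>Serves both designs: the bound on the mass at \<open>all_A\<close> and
  \<open>all_B\<close>, the only assignments that can reveal the estimand, is all that the argument
  uses about \<open>R\<close>. Which of the two families is the bad one depends on
  \<open>T\<close>.\<close>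

lemma MSE_two_point_bound:
  fixes R :: "'n::finite assignment pmf"
  assumes M: "M > 0" and onto: "onto_estimand M g"
    and R: "pmf R all_A + pmf R all_B \<le> 1 / 2"
  shows "\<exists>Y. (\<forall>Z. Y Z \<in> admissible M) \<and> MSE R T g Y \<ge> M\<^sup>2 / 8"
proof -
  from onto M obtain a0 b0 where 0: "a0 \<in> admissible M" "b0 \<in> admissible M" "g a0 b0 = 0"
    unfolding onto_estimand_def by (metis atLeastAtMost_iff less_eq_real_def)
  from onto M obtain a1 b1 where 1: "a1 \<in> admissible M" "b1 \<in> admissible M" "g a1 b1 = M"
    unfolding onto_estimand_def by (metis atLeastAtMost_iff less_eq_real_def)
  \<comment> \<open>The default \<open>a0\<close> is the same whatever \<open>a\<close> and
    \<open>b\<close> are, so both families show identical data away from \<open>all_A\<close> and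
    \<open>all_B\<close>. Arbitrary interference permits such a jump.\<close>
  define Y :: "real ^ 'n \<Rightarrow> real ^ 'n \<Rightarrow> 'n potential_outcomes"
    where "Y a b = (\<lambda>Z. if Z = all_A then a else if Z = all_B then b else a0)" for a b
  have adm: "\<forall>Z. Y a0 b0 Z \<in> admissible M" "\<forall>Z. Y a1 b1 Z \<in> admissible M"
    using 0 1 by (auto simp: Y_def)
  have est: "estimand g (Y a0 b0) = 0" "estimand g (Y a1 b1) = M"
    using 0 1 all_A_neq_all_B[where 'n='n] by (auto simp: Y_def estimand_def)
  define S where "S = - {all_A, all_B :: 'n assignment}"
  have "(\<Sum>Z\<in>UNIV. pmf R Z) = 1"
    by (rule sum_pmf_eq_1) auto
  moreover have "(\<Sum>Z\<in>UNIV. pmf R Z) = (\<Sum>Z\<in>S. pmf R Z) + (\<Sum>Z\<in>{all_A, all_B}. pmf R Z)"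
    using sum.subset_diff[of "{all_A, all_B}" UNIV "pmf R"] by (simp add: S_def Compl_eq_Diff_UNIV)
  ultimately have "1 / 2 \<le> (\<Sum>Z\<in>S. pmf R Z)"
    using R all_A_neq_all_B[where 'n='n] by simp
  then have "M\<^sup>2 / 4 \<le> (\<Sum>Z\<in>S. pmf R Z) * (M\<^sup>2 / 2)"
    using mult_right_mono[of "1/2" _ "M\<^sup>2 / 2"] by fastforce
  also have "\<dots> = (\<Sum>Z\<in>S. pmf R Z * (M\<^sup>2 / 2))"
    by (rule sum_distrib_right)
  \<comment> \<open>On \<open>S\<close> both families show \<open>a0\<close>, so
    \<open>T Z a0\<close> is the common guess for the targets \<open>0\<close> and
    \<open>M\<close>.\<close>
  also have "\<dots> \<le> (\<Sum>Z\<in>S. pmf R Z * ((T Z (Y a0 b0 Z) - 0)\<^sup>2 + (T Z (Y a1 b1 Z) - M)\<^sup>2))"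
  proof (intro sum_mono mult_left_mono)
    fix Z assume "Z \<in> S"
    then show "M\<^sup>2 / 2 \<le> (T Z (Y a0 b0 Z) - 0)\<^sup>2 + (T Z (Y a1 b1 Z) - M)\<^sup>2"
      using sum_squares_two_points[of M "T Z a0"] by (simp add: S_def Y_def)
  qed simp
  also have "\<dots> \<le> (\<Sum>Z\<in>UNIV. pmf R Z * ((T Z (Y a0 b0 Z) - 0)\<^sup>2 + (T Z (Y a1 b1 Z) - M)\<^sup>2))"
    by (rule sum_mono2) auto
  also have "\<dots> = MSE R T g (Y a0 b0) + MSE R T g (Y a1 b1)"
    by (simp add: MSE_eq_sum est distrib_left sum.distrib)
  finally have "M\<^sup>2 / 8 \<le> MSE R T g (Y a0 b0) \<or> M\<^sup>2 / 8 \<le> MSE R T g (Y a1 b1)"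
    by linarith
  with adm show ?thesis by blast
qed

text \<open>Treating exactly a subset of size \<open>NA\<close> with \<open>TrtA\<close> gives a
  member of the set, so \<open>pmf_of_set\<close> has its intended meaning.\<close>

lemma completely_randomized_support:
  assumes "NA + NB = CARD('n::finite)"
  shows "set_pmf (completely_randomized NA NB :: 'n assignment pmf) =
    {Z. card {i. Z i = TrtA} = NA \<and> card {i. Z i = TrtB} = NB}"
proof -
  obtain S :: "'n set" where S: "card S = NA"
    using obtain_subset_with_card_n[of NA "UNIV :: 'n set"] assms by auto
  have "{i. (if i \<in> S then TrtA else TrtB) = TrtA} = S"
    "{i. (if i \<in> S then TrtA else TrtB) = TrtB} = - S"
    by auto
  moreover have "card (- S) = NB"
    using S assms by (simp add: Compl_eq_Diff_UNIV card_Diff_subset)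
  ultimately have "(\<lambda>i. if i \<in> S then TrtA else TrtB) \<in>
      {Z. card {i. Z i = TrtA} = NA \<and> card {i. Z i = TrtB} = NB}"
    using S by simp
  then show ?thesis
    unfolding completely_randomized_def by (intro set_pmf_of_set) auto
qed

lemma pmf_bernoulli_design:
  "pmf (bernoulli_design :: 'n::finite assignment pmf) Z = (1 / 2) ^ CARD('n)"
proof -
  have "pmf (pmf_of_set {TrtA, TrtB}) t = 1 / 2" for t
    by (cases t) simp_all
  then show ?thesis
    by (simp add: bernoulli_design_def pmf_Pi)
qed

theorem theorem2:
  fixes M :: real
    and g :: "real ^ 'n::finite \<Rightarrow> real ^ 'n \<Rightarrow> real"
    and T :: "'n estimator"
  assumes "M > 0"
    and "CARD('n) \<ge> 2"
    and "onto_estimand M g"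
  shows "(\<forall>NA NB. NA \<ge> 1 \<and> NB \<ge> 1 \<and> NA + NB = CARD('n) \<longrightarrow>
            (\<exists>Y. (\<forall>Z. Y Z \<in> admissible M) \<and>
                 MSE (completely_randomized NA NB) T g Y \<ge> M\<^sup>2 / 8))
       \<and> (\<exists>Y. (\<forall>Z. Y Z \<in> admissible M) \<and>
              MSE bernoulli_design T g Y \<ge> M\<^sup>2 / 8)"
proof (intro conjI allI impI)
  fix NA NB :: nat
  assume N: "NA \<ge> 1 \<and> NB \<ge> 1 \<and> NA + NB = CARD('n)"
  \<comment> \<open>\<open>NB \<ge> 1\<close> excludes \<open>all_A\<close> and
    \<open>NA \<ge> 1\<close> excludes \<open>all_B\<close>.\<close>
  then have "all_A \<notin> set_pmf (completely_randomized NA NB :: 'n assignment pmf)"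
    "all_B \<notin> set_pmf (completely_randomized NA NB :: 'n assignment pmf)"
    by (auto simp: completely_randomized_support all_A_def all_B_def)
  then have "pmf (completely_randomized NA NB :: 'n assignment pmf) all_A = 0"
    "pmf (completely_randomized NA NB :: 'n assignment pmf) all_B = 0"
    by (simp_all add: set_pmf_iff)
  then show "\<exists>Y. (\<forall>Z. Y Z \<in> admissible M) \<and>
      MSE (completely_randomized NA NB) T g Y \<ge> M\<^sup>2 / 8"
    by (intro MSE_two_point_bound assms) simp
next
  \<comment> \<open>The sample size enters here: two assignments of mass at most \<open>1/4\<close>
    each have total mass at most \<open>1/2\<close>.\<close>
  have "(1 / 2 :: real) ^ CARD('n) \<le> (1 / 2)\<^sup>2"
    using assms(2) by (intro power_decreasing) auto
  then show "\<exists>Y. (\<forall>Z. Y Z \<in> admissible M) \<and> MSE bernoulli_design T g Y \<ge> M\<^sup>2 / 8"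
    by (intro MSE_two_point_bound assms) (simp add: pmf_bernoulli_design power2_eq_square)
qed

end
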